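(* Every finite dimensional (over $\mathbb{K}$) nilpotent $\mathbb{K}[X]$-module $V$ with one dimensional socle (i.e. $\dim_{\mathbb{K}}\operatorname{Soc}(V)=1$) can be isomorphically embedded in the $\mathbb{K}[X]$-module $T_n$; that is, $V$ is isomorphic as a $\mathbb{K}[X]$-module to a submodule of $T_n$.
   Context: $\mathbb{K}$ is an algebraically closed field of characteristic zero, $n\ge 1$, and $\mathbb{K}[X]:=\mathbb{K}[x_1,\dots,x_n]$ is the polynomial algebra in $n$ variables. $\mathbb{K}_0[X]$ denotes the ideal of $\mathbb{K}[X]$ consisting of polynomials with zero constant term. A $\mathbb{K}[X]$-module $V$ is called nilpotent if $(\mathbb{K}_0[X])^k V=0$ for some natural number $k$. The socle $\operatorname{Soc}(V)$ is the sum of all minimal submodules of $V$. $T_n$ denotes the $\mathbb{K}[X]$-module whose underlying vector space is $\mathbb{K}[X]$ and on which the generators act by $x_i\cdot f=\frac{\partial f}{\partial x_i}$, $i=1,\dots,n$, $f\in T_n$. *)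

theory Defs
  imports "HOL-Library.Poly_Mapping" "HOL-Computational_Algebra.Polynomial"
begin

text \<open>
  Polynomials over \<open>'k\<close> in the variables \<open>x\<^sub>i\<close>, \<open>i :: 'n\<close>, are finitely supported functions from
  exponent vectors to coefficients; for \<open>'n :: finite\<close> the number of variables is \<open>CARD('n) \<ge> 1\<close>.
  Ring structure and convolution product are those of \<open>HOL-Library.Poly_Mapping\<close>.
\<close>

type_synonym ('n, 'k) mpoly = "('n \<Rightarrow>\<^sub>0 nat) \<Rightarrow>\<^sub>0 'k"

definition Const :: "'k \<Rightarrow> ('n, 'k::comm_ring_1) mpoly"
  where "Const c = Poly_Mapping.single 0 c"

definition Var :: "'n \<Rightarrow> ('n, 'k::comm_ring_1) mpoly"
  where "Var i = Poly_Mapping.single (Poly_Mapping.single i 1) 1"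

definition zero_const_ideal :: "('n, 'k::comm_ring_1) mpoly set"
  where "zero_const_ideal = {p. Poly_Mapping.lookup p 0 = 0}"


text \<open>A module over a ring is given by its scalar multiplication (locale \<open>module\<close>); its submodules
  are \<open>module.subspace\<close>, and sums of submodules are spans of unions.\<close>

definition minimal_submodule :: "('r::comm_ring_1 \<Rightarrow> 'v::ab_group_add \<Rightarrow> 'v) \<Rightarrow> 'v set \<Rightarrow> bool"
  where "minimal_submodule s W \<longleftrightarrow> module.subspace s W \<and> W \<noteq> {0} \<and>
    (\<forall>U. module.subspace s U \<and> U \<subseteq> W \<longrightarrow> U = {0} \<or> U = W)"

definition socle :: "('r::comm_ring_1 \<Rightarrow> 'v::ab_group_add \<Rightarrow> 'v) \<Rightarrow> 'v set"
  where "socle s = module.span s (\<Union>{W. minimal_submodule s W})"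

text \<open>Ideals are submodules of the ring acting on itself by multiplication.\<close>

primrec ideal_power :: "'r::comm_ring_1 set \<Rightarrow> nat \<Rightarrow> 'r set" where
  "ideal_power I 0 = UNIV"
| "ideal_power I (Suc k) = module.span (*) {a * b | a b. a \<in> I \<and> b \<in> ideal_power I k}"

definition ideal_smult :: "('r::comm_ring_1 \<Rightarrow> 'v::ab_group_add \<Rightarrow> 'v) \<Rightarrow> 'r set \<Rightarrow> 'v set"
  where "ideal_smult s I = module.span s {s p v | p v. p \<in> I}"

definition nilpotent_module ::
    "(('n, 'k::comm_ring_1) mpoly \<Rightarrow> 'v::ab_group_add \<Rightarrow> 'v) \<Rightarrow> bool"
  where "nilpotent_module s \<longleftrightarrow> (\<exists>k. ideal_smult s (ideal_power zero_const_ideal k) = {0})"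

definition base_scale ::
    "(('n, 'k::comm_ring_1) mpoly \<Rightarrow> 'v::ab_group_add \<Rightarrow> 'v) \<Rightarrow> 'k \<Rightarrow> 'v \<Rightarrow> 'v"
  where "base_scale s c v = s (Const c) v"

lemma vector_space_base_scale:
  fixes s :: "('n, 'k::field) mpoly \<Rightarrow> 'v::ab_group_add \<Rightarrow> 'v"
  assumes "module s"
  shows "vector_space (base_scale s)"
proof -
  interpret module s by fact
  show ?thesis
    by unfold_locales
      (simp_all add: base_scale_def Const_def scale_right_distrib scale_left_distrib
        single_add mult_single)
qed


text \<open>Each summand is \<open>\<partial>/\<partial>x\<^sub>i\<close> of a monomial; when the exponent of \<open>x\<^sub>i\<close> is \<open>0\<close> the truncated
  subtraction is harmless because the coefficient vanishes.\<close>

definition part_deriv :: "'n \<Rightarrow> ('n, 'k::comm_ring_1) mpoly \<Rightarrow> ('n, 'k) mpoly"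
  where "part_deriv i f = (\<Sum>m\<in>Poly_Mapping.keys f.
    Poly_Mapping.single (m - Poly_Mapping.single i 1) (of_nat (Poly_Mapping.lookup m i) * Poly_Mapping.lookup f m))"

text \<open>The iterated derivative with exponent vector \<open>m\<close>; the partial derivatives commute, so the
  order of the variables is irrelevant (\<open>part_deriv_commute\<close>).\<close>

definition mon_deriv :: "('n::finite \<Rightarrow>\<^sub>0 nat) \<Rightarrow> ('n, 'k::comm_ring_1) mpoly \<Rightarrow> ('n, 'k) mpoly"
  where "mon_deriv m f = Finite_Set.fold (\<lambda>i. part_deriv i ^^ Poly_Mapping.lookup m i) f UNIV"

text \<open>The module \<open>T\<^sub>n\<close>: a polynomial \<open>p\<close> acts on polynomials by substituting \<open>\<partial>/\<partial>x\<^sub>i\<close> for \<open>x\<^sub>i\<close> in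
  \<open>p\<close>. See \<open>module_T_scale\<close>, \<open>T_scale_Var\<close>, \<open>T_scale_Const\<close> below.\<close>

definition T_scale ::
    "('n::finite, 'k::comm_ring_1) mpoly \<Rightarrow> ('n, 'k) mpoly \<Rightarrow> ('n, 'k) mpoly"
  where "T_scale p f = (\<Sum>m\<in>Poly_Mapping.keys p. Const (Poly_Mapping.lookup p m) * mon_deriv m f)"

lemma lookup_Const_mult: "Poly_Mapping.lookup (Const c * f) k = c * Poly_Mapping.lookup f k"
proof -
  have "Const c * f = Poly_Mapping.map ((*) c) f"
    by (simp add: Const_def mult_map_scale_conv_mult)
  then show ?thesis by (simp add: Poly_Mapping.map.rep_eq when_def)
qed

lemma lookup_part_deriv:
  "Poly_Mapping.lookup (part_deriv i f) k = of_nat (Poly_Mapping.lookup k i + 1) * Poly_Mapping.lookup f (k + Poly_Mapping.single i 1)"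
proof -
  let ?e = "Poly_Mapping.single i (1::nat)"
  have eq: "m - ?e = k \<longleftrightarrow> m = k + ?e" if "Poly_Mapping.lookup m i \<noteq> 0" for m
  proof
    assume "m - ?e = k"
    moreover have "m = (m - ?e) + ?e"
      using that by (intro poly_mapping_eqI) (auto simp: lookup_add lookup_minus lookup_single when_def)
    ultimately show "m = k + ?e" by simp
  qed simp
  have "Poly_Mapping.lookup (part_deriv i f) k =
      (\<Sum>m\<in>Poly_Mapping.keys f. (of_nat (Poly_Mapping.lookup m i) * Poly_Mapping.lookup f m) when m - ?e = k)"
    by (simp add: part_deriv_def lookup_sum lookup_single)
  also have "\<dots> = (\<Sum>m\<in>Poly_Mapping.keys f. if m = k + ?e then of_nat (Poly_Mapping.lookup m i) * Poly_Mapping.lookup f m else 0)"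
  proof (rule sum.cong)
    fix m
    show "(of_nat (Poly_Mapping.lookup m i) * Poly_Mapping.lookup f m when m - ?e = k) =
        (if m = k + ?e then of_nat (Poly_Mapping.lookup m i) * Poly_Mapping.lookup f m else 0)"
    proof (cases "Poly_Mapping.lookup m i = 0")
      case True
      then show ?thesis by (simp only: of_nat_0 mult_zero_left when_def if_cancel)
    next
      case False
      show ?thesis by (simp only: when_def eq[OF False])
    qed
  qed simp
  also have "\<dots> = of_nat (Poly_Mapping.lookup k i + 1) * Poly_Mapping.lookup f (k + ?e)"
    by (simp add: sum.delta in_keys_iff lookup_add)
  finally show ?thesis .
qed

lemma part_deriv_add: "part_deriv i (f + g) = part_deriv i f + part_deriv i g"
  by (rule poly_mapping_eqI) (simp add: lookup_part_deriv lookup_add algebra_simps)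

lemma part_deriv_Const_mult: "part_deriv i (Const c * f) = Const c * part_deriv i f"
  by (rule poly_mapping_eqI) (simp add: lookup_part_deriv lookup_Const_mult mult.left_commute)

lemma part_deriv_commute: "part_deriv i (part_deriv j f) = part_deriv j (part_deriv i f)"
  by (rule poly_mapping_eqI)
    (auto simp: lookup_part_deriv lookup_add lookup_single when_def algebra_simps)

lemma part_deriv_pow_commute:
  "(part_deriv i ^^ a) ((part_deriv j ^^ b) f) = (part_deriv j ^^ b) ((part_deriv i ^^ a) f)"
proof -
  have 1: "(part_deriv i ^^ a) (part_deriv j g) = part_deriv j ((part_deriv i ^^ a) g)" for a g
    by (induction a) (simp_all add: part_deriv_commute)
  show ?thesis
    by (induction b) (simp_all add: 1)
qed

interpretation part_deriv_fold: comp_fun_commute "\<lambda>i. part_deriv i ^^ Poly_Mapping.lookup m i"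
  by unfold_locales (auto simp: fun_eq_iff part_deriv_pow_commute)

lemma mon_deriv_zero: "mon_deriv 0 f = f"
proof -
  have "Finite_Set.fold (\<lambda>i. part_deriv i ^^ Poly_Mapping.lookup (0::'a \<Rightarrow>\<^sub>0 nat) i) f A = f"
    if "finite A" for A
    using that
  proof (induction A)
    case (insert x A)
    then show ?case
      unfolding part_deriv_fold.fold_insert[OF insert(1,2)] insert.IH by simp
  qed simp
  then show ?thesis by (simp add: mon_deriv_def)
qed

lemma mon_deriv_plus:
  fixes f :: "('a::finite, 'b::comm_ring_1) mpoly"
  shows "mon_deriv (m + m') f = mon_deriv m (mon_deriv m' f)"
proof -
  let ?F = "\<lambda>m f A. Finite_Set.fold (\<lambda>i. part_deriv i ^^ Poly_Mapping.lookup m i) f A"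
  have 1: "(part_deriv (x::'a) ^^ b) (?F m g A) = ?F m ((part_deriv x ^^ b) g) A"
    if "finite A" for A x b and m :: "'a \<Rightarrow>\<^sub>0 nat" and g :: "('a, 'b) mpoly"
    using that by (induction A) (simp_all add: part_deriv_fold.fold_insert part_deriv_pow_commute[where i = x and a = b])
  have "?F (m + m') f A = ?F m (?F m' f A) A" if "finite A" for A
    using that
  proof (induction A)
    case (insert x A)
    then show ?case
      unfolding part_deriv_fold.fold_insert[OF insert(1,2)] insert.IH
      by (simp add: lookup_add funpow_add 1[OF insert(1)])
  qed simp
  then show ?thesis by (simp add: mon_deriv_def)
qed

lemma part_deriv_pow_add: "(part_deriv i ^^ a) (f + g) = (part_deriv i ^^ a) f + (part_deriv i ^^ a) g"
  by (induction a) (simp_all add: part_deriv_add)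

lemma part_deriv_pow_Const_mult: "(part_deriv i ^^ a) (Const c * f) = Const c * (part_deriv i ^^ a) f"
  by (induction a) (simp_all add: part_deriv_Const_mult)

lemma mon_deriv_add: "mon_deriv m (f + g) = mon_deriv m f + mon_deriv m g"
proof -
  let ?F = "\<lambda>f A. Finite_Set.fold (\<lambda>i. part_deriv i ^^ Poly_Mapping.lookup m i) f A"
  have "?F (f + g) A = ?F f A + ?F g A" if "finite A" for A
    using that by (induction A) (simp_all add: part_deriv_fold.fold_insert part_deriv_pow_add)
  then show ?thesis by (simp add: mon_deriv_def)
qed

lemma mon_deriv_Const_mult: "mon_deriv m (Const c * f) = Const c * mon_deriv m f"
proof -
  let ?F = "\<lambda>f A. Finite_Set.fold (\<lambda>i. part_deriv i ^^ Poly_Mapping.lookup m i) f A"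
  have "?F (Const c * f) A = Const c * ?F f A" if "finite A" for A
    using that by (induction A) (simp_all add: part_deriv_fold.fold_insert part_deriv_pow_Const_mult)
  then show ?thesis by (simp add: mon_deriv_def)
qed

lemma T_scale_superset:
  assumes "finite A" "Poly_Mapping.keys p \<subseteq> A"
  shows "T_scale p f = (\<Sum>m\<in>A. Const (Poly_Mapping.lookup p m) * mon_deriv m f)"
  unfolding T_scale_def using assms
  by (intro sum.mono_neutral_left) (auto simp: in_keys_iff Const_def)

lemma T_scale_single: "T_scale (Poly_Mapping.single m c) f = Const c * mon_deriv m f"
  by (subst T_scale_superset[of "{m}"]) auto

lemma T_scale_add_left: "T_scale (p + q) f = T_scale p f + T_scale q f"
proof -
  let ?A = "Poly_Mapping.keys p \<union> Poly_Mapping.keys q"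
  have "Poly_Mapping.keys (p + q) \<subseteq> ?A" by (rule Poly_Mapping.keys_add)
  then show ?thesis
    by (subst (1 2 3) T_scale_superset[of ?A])
      (auto simp: lookup_add Const_def single_add distrib_right sum.distrib)
qed

lemma T_scale_add_right: "T_scale p (f + g) = T_scale p f + T_scale p g"
  by (simp add: T_scale_def mon_deriv_add distrib_left sum.distrib)

lemma mpoly_additive_induct:
  assumes "\<And>m c. P (Poly_Mapping.single m c)" "\<And>p q. P p \<Longrightarrow> P q \<Longrightarrow> P (p + q)"
  shows "P (p :: ('n, 'k::comm_ring_1) mpoly)"
proof -
  have *: "P (\<Sum>m\<in>A. Poly_Mapping.single m (Poly_Mapping.lookup p m))" if "finite A" for A
    using that
  proof (induction A)
    case empty
    then show ?case using assms(1)[of 0 0] by simp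
  qed (simp add: assms)
  have "p = (\<Sum>m\<in>Poly_Mapping.keys p. Poly_Mapping.single m (Poly_Mapping.lookup p m))"
    by (rule poly_mapping_eqI)
      (auto simp: lookup_sum lookup_single when_def sum.delta in_keys_iff)
  then show ?thesis using * by (metis finite_keys)
qed

lemma T_scale_mult: "T_scale (p * q) f = T_scale p (T_scale q f)"
proof (induction p rule: mpoly_additive_induct)
  case (1 m c)
  show ?case
  proof (induction q rule: mpoly_additive_induct)
    case (1 m' d)
    show ?case
      by (simp add: mult_single T_scale_single mon_deriv_plus mon_deriv_Const_mult)
        (simp add: Const_def mult_single flip: mult.assoc)
  qed (simp add: distrib_left T_scale_add_left T_scale_add_right)
qed (simp add: distrib_right T_scale_add_left)

lemma T_scale_Const: "T_scale (Const c) f = Const c * f"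
  unfolding Const_def[of c] T_scale_single by (simp add: mon_deriv_zero Const_def)

lemma module_T_scale: "module (T_scale :: ('n::finite, 'k::comm_ring_1) mpoly \<Rightarrow> _)"
proof
  show "T_scale 1 f = f" for f :: "('n, 'k) mpoly"
    using T_scale_Const[of 1 f] by (simp add: Const_def)
qed (simp_all add: T_scale_add_left T_scale_add_right T_scale_mult)

lemma T_scale_Var: "T_scale (Var i) f = part_deriv i f"
proof -
  let ?F = "\<lambda>A. Finite_Set.fold
    (\<lambda>j. part_deriv j ^^ Poly_Mapping.lookup (Poly_Mapping.single i (1::nat)) j) f A"
  have "?F A = (if i \<in> A then part_deriv i f else f)" if "finite A" for A
    using that
  proof (induction A)
    case (insert x A)
    then show ?case
      by (subst part_deriv_fold.fold_insert) (auto simp: lookup_single when_def)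
  qed simp
  then have "mon_deriv (Poly_Mapping.single i 1) f = part_deriv i f"
    by (simp add: mon_deriv_def)
  then show ?thesis by (simp add: Var_def T_scale_single) (simp add: Const_def)
qed

end

theory Submission
  imports Defs
begin

text \<open>
  If \<open>\<lambda>\<close> is a \<open>\<K>\<close>-linear functional on \<open>V\<close>, then \<open>\<phi>(v)(t) = \<lambda>(exp(t\<^sub>1 x\<^sub>1 + \<dots> + t\<^sub>n x\<^sub>n) \<cdot> v)\<close>, expanded as
  a power series \<open>\<Sum>\<^sub>m \<lambda>(x\<^sup>m v) / m! t\<^sup>m\<close>, is a polynomial because \<open>V\<close> is nilpotent, and differentiating
  the exponential by \<open>t\<^sub>i\<close> multiplies it by \<open>x\<^sub>i\<close>. So \<open>\<phi>\<close> is a module homomorphism from \<open>V\<close> to \<open>T\<^sub>n\<close>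
  (\<open>module_hom_exp_pairing\<close>). The constant term of \<open>\<phi>(v)\<close> is \<open>\<lambda>(v)\<close>, so the kernel of \<open>\<phi>\<close> is a
  submodule on which \<open>\<lambda>\<close> vanishes.

  It remains to choose \<open>\<lambda>\<close> so that no nonzero submodule lies in its kernel. Since \<open>V\<close> is finite
  dimensional, every nonzero submodule contains a minimal one (\<open>obtain_minimal_submodule\<close>) and hence
  a nonzero element of the socle. As the socle is a line, it suffices that \<open>\<lambda>\<close> does not vanish on a
  vector spanning that line.
\<close>

section \<open>Monomials\<close>

lemma exponent_neq_0_split:
  fixes m :: "'n \<Rightarrow>\<^sub>0 nat"
  assumes "m \<noteq> 0"
  obtains i m' where "m = Poly_Mapping.single i 1 + m'"
proof -
  obtain i where i: "Poly_Mapping.lookup m i \<noteq> 0"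
    using assms by (metis lookup_zero poly_mapping_eqI)
  have "m = Poly_Mapping.single i 1 + (m - Poly_Mapping.single i 1)"
    using i by (intro poly_mapping_eqI) (auto simp: lookup_add lookup_minus lookup_single when_def)
  then show thesis by (rule that)
qed

lemma sum_lookup_single_add:
  fixes m :: "'n::finite \<Rightarrow>\<^sub>0 nat"
  shows "(\<Sum>j\<in>UNIV. Poly_Mapping.lookup (Poly_Mapping.single i 1 + m) j) =
    Suc (\<Sum>j\<in>UNIV. Poly_Mapping.lookup m j)"
  by (simp add: lookup_add lookup_single sum.distrib when_def)

lemma exponent_induct [case_names zero add_single]:
  fixes m :: "'n::finite \<Rightarrow>\<^sub>0 nat"
  assumes "P 0" and "\<And>i m. P m \<Longrightarrow> P (Poly_Mapping.single i 1 + m)"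
  shows "P m"
proof (induction "\<Sum>j\<in>UNIV. Poly_Mapping.lookup m j" arbitrary: m rule: less_induct)
  case less
  show ?case
  proof (cases "m = 0")
    case False
    then obtain i m' where m: "m = Poly_Mapping.single i 1 + m'" by (rule exponent_neq_0_split)
    have "P m'" by (rule less) (simp only: m sum_lookup_single_add lessI)
    then show ?thesis unfolding m by (rule assms(2))
  qed (simp add: assms(1))
qed

lemma monomial_single_add:
  "Poly_Mapping.single (Poly_Mapping.single i 1 + m) 1 = Var i * (Poly_Mapping.single m 1 :: ('n, 'k::comm_ring_1) mpoly)"
  by (simp add: Var_def mult_single)

lemma single_eq_Const_mult:
  "Poly_Mapping.single m c = Const c * (Poly_Mapping.single m 1 :: ('n, 'k::comm_ring_1) mpoly)"
  by (simp add: Const_def mult_single)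

text \<open>Reduces linearity over \<open>\<K>[X]\<close> to linearity over \<open>\<K>\<close> and compatibility with each \<open>x\<^sub>i\<close>.\<close>

lemma mpoly_generators_induct [case_names Const Var add mult]:
  fixes p :: "('n::finite, 'k::comm_ring_1) mpoly"
  assumes Const: "\<And>c. P (Const c)" and Var: "\<And>i. P (Var i)"
    and add: "\<And>p q. P p \<Longrightarrow> P q \<Longrightarrow> P (p + q)"
    and mult: "\<And>p q. P p \<Longrightarrow> P q \<Longrightarrow> P (p * q)"
  shows "P p"
proof (induction p rule: mpoly_additive_induct)
  case (1 m c)
  have "P (Poly_Mapping.single m 1)"
  proof (induction m rule: exponent_induct)
    case zero
    show ?case using Const[of 1] by (simp add: Const_def)
  next
    case (add_single i m)
    then show ?case unfolding monomial_single_add by (rule mult[OF Var])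
  qed
  then show ?case by (subst single_eq_Const_mult) (rule mult[OF Const])
qed (rule add)

definition exponent_fact :: "('n::finite \<Rightarrow>\<^sub>0 nat) \<Rightarrow> 'k::field_char_0"
  where "exponent_fact m = (\<Prod>i\<in>UNIV. fact (Poly_Mapping.lookup m i))"

lemma exponent_fact_0 [simp]: "exponent_fact 0 = 1"
  by (simp add: exponent_fact_def)

lemma exponent_fact_neq_0 [simp]: "exponent_fact m \<noteq> 0"
  by (simp add: exponent_fact_def)

lemma exponent_fact_single_add:
  "(exponent_fact (Poly_Mapping.single i 1 + m) :: 'k::field_char_0) =
    of_nat (Poly_Mapping.lookup m i + 1) * exponent_fact m"
proof -
  have "fact (Poly_Mapping.lookup (Poly_Mapping.single i 1 + m) j) =
      (if j = i then of_nat (Poly_Mapping.lookup m i + 1) else 1) * (fact (Poly_Mapping.lookup m j) :: 'k)" for j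
    by (auto simp: lookup_add lookup_single)
  then show ?thesis by (simp add: exponent_fact_def prod.distrib)
qed

section \<open>Nilpotent modules\<close>

text \<open>A monomial of degree at least \<open>k\<close> is a product of \<open>k\<close> variables and another monomial.\<close>

lemma monomial_in_ideal_power:
  fixes m :: "'n::finite \<Rightarrow>\<^sub>0 nat"
  assumes "k \<le> (\<Sum>i\<in>UNIV. Poly_Mapping.lookup m i)"
  shows "Poly_Mapping.single m 1 \<in> ideal_power (zero_const_ideal :: ('n, 'k::comm_ring_1) mpoly set) k"
  using assms
proof (induction k arbitrary: m)
  case (Suc k)
  interpret R: module "(*) :: ('n, 'k) mpoly \<Rightarrow> _"
    by unfold_locales (simp_all add: algebra_simps)
  from Suc.prems have "m \<noteq> 0" by auto
  then obtain i m' where m: "m = Poly_Mapping.single i 1 + m'" by (rule exponent_neq_0_split)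
  have "k \<le> (\<Sum>i\<in>UNIV. Poly_Mapping.lookup m' i)"
    using Suc.prems by (simp only: m sum_lookup_single_add)
  then have "Poly_Mapping.single m' 1 \<in> ideal_power (zero_const_ideal :: ('n, 'k) mpoly set) k"
    by (rule Suc.IH)
  moreover have "Var i \<in> (zero_const_ideal :: ('n, 'k) mpoly set)"
    by (simp add: zero_const_ideal_def Var_def lookup_single flip: poly_mapping.lookup_inject)
      (simp add: fun_eq_iff lookup_single when_def)
  ultimately show ?case
    unfolding m monomial_single_add by (auto intro!: R.span_base)
qed simp

lemma finite_exponents_of_bounded_degree:
  "finite {m :: 'n::finite \<Rightarrow>\<^sub>0 nat. (\<Sum>i\<in>UNIV. Poly_Mapping.lookup m i) < k}"
proof (rule finite_imageD)
  have "Poly_Mapping.lookup m i < k" if "(\<Sum>i\<in>UNIV. Poly_Mapping.lookup m i) < k"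
    for m :: "'n \<Rightarrow>\<^sub>0 nat" and i
    using member_le_sum[of i UNIV "Poly_Mapping.lookup m"] that by simp
  then have "Poly_Mapping.lookup ` {m :: 'n \<Rightarrow>\<^sub>0 nat. (\<Sum>i\<in>UNIV. Poly_Mapping.lookup m i) < k}
      \<subseteq> {f. \<forall>i. (i \<in> UNIV \<longrightarrow> f i \<in> {..<k}) \<and> (i \<notin> UNIV \<longrightarrow> f i = 0)}"
    by auto
  then show "finite (Poly_Mapping.lookup ` {m :: 'n \<Rightarrow>\<^sub>0 nat. (\<Sum>i\<in>UNIV. Poly_Mapping.lookup m i) < k})"
    by (rule finite_subset) (intro finite_set_of_finite_funs; simp)
qed (simp add: inj_on_def)

text \<open>Nilpotency enters only here: it makes the power series \<open>\<phi>(v)\<close> a polynomial.\<close>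

lemma nilpotent_module_finite_monomials:
  fixes s :: "('n::finite, 'k::comm_ring_1) mpoly \<Rightarrow> 'v::ab_group_add \<Rightarrow> 'v"
  assumes "module s" and "nilpotent_module s"
  shows "finite {m. s (Poly_Mapping.single m 1) v \<noteq> 0}"
proof -
  interpret module s by fact
  obtain k where k: "ideal_smult s (ideal_power zero_const_ideal k) = {0}"
    using assms(2) by (auto simp: nilpotent_module_def)
  have "s (Poly_Mapping.single m 1) v = 0" if "k \<le> (\<Sum>i\<in>UNIV. Poly_Mapping.lookup m i)" for m
  proof -
    have "s (Poly_Mapping.single m 1) v \<in> ideal_smult s (ideal_power zero_const_ideal k)"
      unfolding ideal_smult_def using monomial_in_ideal_power[OF that] by (blast intro: span_base)
    then show ?thesis by (simp add: k)
  qed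
  then have "{m. s (Poly_Mapping.single m 1) v \<noteq> 0}
      \<subseteq> {m. (\<Sum>i\<in>UNIV. Poly_Mapping.lookup m i) < k}"
    using not_le by blast
  then show ?thesis by (rule finite_subset) (rule finite_exponents_of_bounded_degree)
qed

section \<open>The homomorphism given by a linear functional\<close>

text \<open>The expansion of \<open>\<lambda>(exp(t\<^sub>1 x\<^sub>1 + \<dots> + t\<^sub>n x\<^sub>n) \<cdot> v)\<close> in powers of \<open>t\<close>. The coefficients form a
  polynomial only if almost all monomials annihilate \<open>v\<close>; otherwise the value is unspecified.\<close>

definition exp_pairing ::
    "(('n::finite, 'k::field_char_0) mpoly \<Rightarrow> 'v \<Rightarrow> 'v) \<Rightarrow> ('v \<Rightarrow> 'k) \<Rightarrow> 'v \<Rightarrow> ('n, 'k) mpoly"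
  where "exp_pairing s l v =
    Abs_poly_mapping (\<lambda>m. l (s (Poly_Mapping.single m 1) v) / exponent_fact m)"

lemma lookup_exp_pairing:
  fixes s :: "('n::finite, 'k::field_char_0) mpoly \<Rightarrow> 'v::ab_group_add \<Rightarrow> 'v"
  assumes "module s" and "nilpotent_module s" and "l 0 = 0"
  shows "Poly_Mapping.lookup (exp_pairing s l v) m = l (s (Poly_Mapping.single m 1) v) / exponent_fact m"
proof -
  have "finite {m. l (s (Poly_Mapping.single m 1) v) / exponent_fact m \<noteq> 0}"
    by (rule finite_subset[OF _ nilpotent_module_finite_monomials[OF assms(1,2), of v]])
      (use assms(3) in auto)
  then show ?thesis by (simp add: exp_pairing_def)
qed

text \<open>For \<open>x\<^sub>i\<close> this is \<open>\<partial>/\<partial>t\<^sub>i exp(t\<^sub>i x\<^sub>i) = x\<^sub>i exp(t\<^sub>i x\<^sub>i)\<close>: on coefficients, \<open>(m\<^sub>i + 1) / (m + e\<^sub>i)! = 1 / m!\<close>.\<close>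

lemma module_hom_exp_pairing:
  fixes s :: "('n::finite, 'k::field_char_0) mpoly \<Rightarrow> 'v::ab_group_add \<Rightarrow> 'v"
  assumes s: "module s" and nil: "nilpotent_module s" and l: "Vector_Spaces.linear (base_scale s) (*) l"
  shows "module_hom s T_scale (exp_pairing s l)"
proof -
  interpret module s by fact
  interpret l: Vector_Spaces.linear "base_scale s" "(*)" l by fact
  note lookup = lookup_exp_pairing[where l = l, OF s nil l.zero]
  have additive: "exp_pairing s l (v + w) = exp_pairing s l v + exp_pairing s l w" for v w
    by (rule poly_mapping_eqI)
      (simp add: lookup lookup_add scale_right_distrib l.add add_divide_distrib)
  have scale: "exp_pairing s l (s p v) = T_scale p (exp_pairing s l v)" for p v
  proof (induction p arbitrary: v rule: mpoly_generators_induct)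
    case (Const c)
    have "l (s (Poly_Mapping.single m 1) (s (Const c) v)) = c * l (s (Poly_Mapping.single m 1) v)" for m
      using l.scale[of c "s (Poly_Mapping.single m 1) v"]
      by (simp add: base_scale_def mult.commute)
    then show ?case
      by (intro poly_mapping_eqI) (simp add: lookup T_scale_Const lookup_Const_mult)
  next
    case (Var i)
    show ?case
    proof (rule poly_mapping_eqI)
      fix m
      have "s (Poly_Mapping.single m 1) (s (Var i) v) = s (Poly_Mapping.single (Poly_Mapping.single i 1 + m) 1) v"
        by (simp only: monomial_single_add scale_scale mult.commute)
      then show "Poly_Mapping.lookup (exp_pairing s l (s (Var i) v)) m =
          Poly_Mapping.lookup (T_scale (Var i) (exp_pairing s l v)) m"
        unfolding T_scale_Var lookup_part_deriv lookup add.commute[of m] exponent_fact_single_add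
        by (simp del: of_nat_Suc of_nat_add)
    qed
  next
    case (add p q)
    then show ?case by (simp add: scale_left_distrib additive T_scale_add_left)
  next
    case (mult p q)
    then show ?case by (simp add: T_scale_mult flip: scale_scale)
  qed
  show ?thesis
    by (simp add: module_hom_iff s module_T_scale additive scale)
qed

section \<open>Minimal submodules and the socle\<close>

lemma subspace_base_scale:
  fixes s :: "('n, 'k::field) mpoly \<Rightarrow> 'v::ab_group_add \<Rightarrow> 'v"
  assumes "module s" and "module.subspace s U"
  shows "module.subspace (base_scale s) U"
proof -
  interpret module s by fact
  interpret b: vector_space "base_scale s" by (rule vector_space_base_scale[OF assms(1)])
  show ?thesis
    using assms(2) by (simp add: subspace_def b.subspace_def base_scale_def)
qed

text \<open>A nonzero submodule of least dimension over \<open>\<K>\<close> is minimal.\<close>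

lemma obtain_minimal_submodule:
  fixes s :: "('n, 'k::field) mpoly \<Rightarrow> 'v::ab_group_add \<Rightarrow> 'v"
  assumes s: "module s" and fin: "finite_dimensional_vector_space (base_scale s) B"
    and U: "module.subspace s U" "U \<noteq> {0}"
  obtains W where "minimal_submodule s W" "W \<subseteq> U"
proof -
  interpret b: finite_dimensional_vector_space "base_scale s" B by fact
  let ?P = "\<lambda>W. module.subspace s W \<and> W \<noteq> {0} \<and> W \<subseteq> U"
  obtain W where W: "?P W" and least: "\<And>W'. ?P W' \<Longrightarrow> b.dim W \<le> b.dim W'"
    using ex_has_least_nat[of ?P U b.dim] U by auto
  have "minimal_submodule s W"
    unfolding minimal_submodule_def
  proof (intro conjI allI impI)
    fix W' assume W': "module.subspace s W' \<and> W' \<subseteq> W"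
    show "W' = {0} \<or> W' = W"
    proof (cases "W' = {0}")
      case False
      then have "b.dim W \<le> b.dim W'" using W W' by (intro least) auto
      then have "W' = W"
        using W W' by (intro b.subspace_dim_equal) (auto intro: subspace_base_scale[OF s])
      then show ?thesis ..
    qed simp
  qed (use W in auto)
  then show thesis using W by (intro that) auto
qed

text \<open>Finite dimensional modules have essential socle.\<close>

lemma socle_meets_submodule:
  fixes s :: "('n, 'k::field) mpoly \<Rightarrow> 'v::ab_group_add \<Rightarrow> 'v"
  assumes s: "module s" and fin: "finite_dimensional_vector_space (base_scale s) B"
    and U: "module.subspace s U" "U \<noteq> {0}"
  obtains w where "w \<in> U" "w \<in> socle s" "w \<noteq> 0"
proof -
  interpret module s by fact
  obtain W where W: "minimal_submodule s W" "W \<subseteq> U"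
    using obtain_minimal_submodule[OF assms] .
  then have "subspace W" "W \<noteq> {0}" by (auto simp: minimal_submodule_def)
  then obtain w where w: "w \<in> W" "w \<noteq> 0" using subspace_0 by blast
  then have "w \<in> socle s" unfolding socle_def using W by (blast intro: span_base)
  then show thesis using w W by (intro that) auto
qed

section \<open>The embedding\<close>

theorem theorem1:
  fixes s :: "('n::finite, 'k::{alg_closed_field, field_char_0}) mpoly \<Rightarrow> 'v::ab_group_add \<Rightarrow> 'v"
  assumes "module s"
    and "\<exists>B. finite_dimensional_vector_space (base_scale s) B"
    and "nilpotent_module s"
    and "vector_space.dim (base_scale s) (socle s) = 1"
  shows "\<exists>W \<phi>. module.subspace T_scale W \<and> module_hom s T_scale \<phi> \<and> bij_betw \<phi> UNIV W"
proof -
  interpret module s by fact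
  interpret b: vector_space "base_scale s" by (rule vector_space_base_scale[OF assms(1)])
  interpret k: vector_space "(*) :: 'k \<Rightarrow> _" by unfold_locales (simp_all add: algebra_simps)
  interpret bk: vector_space_pair "base_scale s" "(*) :: 'k \<Rightarrow> _" ..
  obtain B where B: "finite_dimensional_vector_space (base_scale s) B" using assms(2) ..
  obtain C where C: "C \<subseteq> socle s" "b.independent C" "socle s \<subseteq> b.span C" "card C = 1"
    using b.basis_exists[of "socle s"] assms(4) by metis
  then obtain u where u: "C = {u}" by (auto simp: card_1_singleton_iff)
  obtain l where l: "Vector_Spaces.linear (base_scale s) (*) l" and lu: "l u = 1"
    using bk.linear_independent_extend[OF C(2), of "\<lambda>_. 1"] u by auto
  interpret l: Vector_Spaces.linear "base_scale s" "(*)" l by fact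
  let ?\<phi> = "exp_pairing s l"
  interpret \<phi>: module_hom s T_scale ?\<phi>
    by (rule module_hom_exp_pairing[OF assms(1,3) l])
  \<comment> \<open>The constant term of \<open>\<phi>(v)\<close> is \<open>\<lambda>(v)\<close>.\<close>
  have l_ker: "l v = 0" if "?\<phi> v = 0" for v
    using lookup_exp_pairing[where l = l and v = v and m = 0, OF assms(1,3) l.zero] that by simp
  have "{v. ?\<phi> v = 0} = {0}"
  proof (rule ccontr)
    assume "{v. ?\<phi> v = 0} \<noteq> {0}"
    then obtain w where w: "?\<phi> w = 0" "w \<in> socle s" "w \<noteq> 0"
      using socle_meets_submodule[OF assms(1) B \<phi>.subspace_kernel] by blast
    then obtain c where c: "w = base_scale s c u"
      using C(3) by (auto simp: u b.span_singleton)
    have "c = l w" by (simp add: c l.scale lu)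
    also have "l w = 0" using w(1) by (rule l_ker)
    finally show False using c w(3) by simp
  qed
  then have "inj ?\<phi>" unfolding \<phi>.inj_iff_eq_0 by auto
  then have "bij_betw ?\<phi> UNIV (range ?\<phi>)" by (rule inj_on_imp_bij_betw)
  then show ?thesis
    using \<phi>.subspace_image[OF subspace_UNIV] \<phi>.module_hom_axioms by blast
qed

end
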